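(* Let $\omega^1,\dots,\omega^4$ be a basis of $\Lambda^{1,0}(\mathbb C^4)^*$, and let $\varphi^1=\omega^{12}$, $\varphi^2=\omega^{13}$, $\varphi^3=\omega^{14}$, $\varphi^4=\omega^{23}$, $\varphi^5=-\omega^{24}$, $\varphi^6=\omega^{34}$. Let $\Theta=\sum_{j,k=1}^6a_{j,k}\,\varphi^j\wedge\overline{\varphi^k}$ be a real $(2,2)$-form on $\mathbb C^4$ with associated Hermitian matrix $A_\Theta=(a_{j,k})$. If $\Theta$ is weakly positive, then for all $(j,k),(l,m)\in\{(1,6),(2,5),(3,4)\}$ with $(j,k)\neq(l,m)$, $$|a_{j,k}\pm a_{l,m}|\le\frac{a_{j,j}+a_{k,k}+a_{l,l}+a_{m,m}}{2}$$ (for both choices of sign). In particular, $|a_{1,6}|,|a_{2,5}|,|a_{3,4}|\le\frac{\operatorname{tr}A_\Theta}{2}$.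
   Context: $\omega^{jk}=\omega^j\wedge\omega^k$. The volume form is $\mathrm{Vol}=\omega^1\wedge\omega^2\wedge\omega^3\wedge\omega^4\wedge\bar\omega^1\wedge\bar\omega^2\wedge\bar\omega^3\wedge\bar\omega^4$, and a $(4,4)$-form is non-negative if it is a non-negative real multiple of $\mathrm{Vol}$. A $(2,2)$-form is real if it equals its complex conjugate. A real $(2,2)$-form $\Theta$ on $\mathbb C^4$ is weakly positive if $\Theta\wedge\psi\wedge\bar\psi$ is non-negative for every decomposable $\psi\in\Lambda^{2,0}(\mathbb C^4)^*$, i.e. every $\psi$ of the form $\mu_1\wedge\mu_2$ with $\mu_1,\mu_2$ of type $(1,0)$. *)

theory Defs
  imports "HOL-Analysis.Analysis" "HOL-Library.Function_Algebras"
begin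

text \<open>
  Complex-valued forms on \<open>\<complex>\<^sup>4\<close>. A form of degree \<open>p\<close> is a function of a sequence of vectors that
  depends only on the entries \<open>0, \<dots>, p - 1\<close>; the degree is not recorded in the type, so
  the wedge product takes the two degrees as arguments. Forms are added pointwise.
\<close>

type_synonym form = "(nat \<Rightarrow> complex^4) \<Rightarrow> complex"

definition scale_form :: "complex \<Rightarrow> form \<Rightarrow> form" (infixr "*\<^sub>F" 75) where
  "c *\<^sub>F \<alpha> = (\<lambda>v. c * \<alpha> v)"

interpretation form: vector_space scale_form
  by unfold_locales (auto simp: scale_form_def fun_eq_iff algebra_simps)

definition cnj_form :: "form \<Rightarrow> form" where
  "cnj_form \<alpha> = (\<lambda>v. cnj (\<alpha> v))"

text \<open>
  Normalised so that \<open>(\<mu>\<^sub>1 \<and> \<dots> \<and> \<mu>\<^sub>k)(v\<^sub>1, \<dots>, v\<^sub>k) = det (\<mu>\<^sub>i (v\<^sub>j))\<close> for forms of degree 1.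
\<close>

definition wedge :: "nat \<Rightarrow> nat \<Rightarrow> form \<Rightarrow> form \<Rightarrow> form" where
  "wedge p q \<alpha> \<beta> = (\<lambda>v.
     (\<Sum>\<sigma> | \<sigma> permutes {..<p + q}.
        of_int (sign \<sigma>) * \<alpha> (\<lambda>i. v (\<sigma> i)) * \<beta> (\<lambda>i. v (\<sigma> (p + i))))
     / (fact p * fact q))"

fun wedge_list :: "form list \<Rightarrow> form" where
  "wedge_list [] = (\<lambda>v. 1)"
| "wedge_list (\<mu> # \<mu>s) = wedge 1 (length \<mu>s) \<mu> (wedge_list \<mu>s)"

definition forms_1_0 :: "form set" where
  "forms_1_0 = {\<mu>. \<exists>f. Vector_Spaces.linear (*s) (*) f \<and> \<mu> = (\<lambda>v. f (v 0))}"

definition forms :: "nat \<Rightarrow> nat \<Rightarrow> form set" where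
  "forms p q = form.span
     {wedge p q (wedge_list \<mu>s) (cnj_form (wedge_list \<nu>s)) | \<mu>s \<nu>s.
        length \<mu>s = p \<and> length \<nu>s = q \<and> set \<mu>s \<subseteq> forms_1_0 \<and> set \<nu>s \<subseteq> forms_1_0}"

definition basis_1_0 :: "(4 \<Rightarrow> form) \<Rightarrow> bool" where
  "basis_1_0 \<omega> \<longleftrightarrow> inj \<omega> \<and> form.independent (range \<omega>) \<and> form.span (range \<omega>) = forms_1_0"

definition Vol :: "(4 \<Rightarrow> form) \<Rightarrow> form" where
  "Vol \<omega> = wedge_list [\<omega> 1, \<omega> 2, \<omega> 3, \<omega> 4,
     cnj_form (\<omega> 1), cnj_form (\<omega> 2), cnj_form (\<omega> 3), cnj_form (\<omega> 4)]"

definition nonneg_4_4 :: "(4 \<Rightarrow> form) \<Rightarrow> form \<Rightarrow> bool" where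
  "nonneg_4_4 \<omega> \<Omega> \<longleftrightarrow> (\<exists>c::real. 0 \<le> c \<and> \<Omega> = complex_of_real c *\<^sub>F Vol \<omega>)"

definition real_2_2_form :: "form \<Rightarrow> bool" where
  "real_2_2_form \<Theta> \<longleftrightarrow> \<Theta> \<in> forms 2 2 \<and> cnj_form \<Theta> = \<Theta>"

definition decomposable_2_0 :: "form set" where
  "decomposable_2_0 = {wedge 1 1 \<mu>\<^sub>1 \<mu>\<^sub>2 | \<mu>\<^sub>1 \<mu>\<^sub>2. \<mu>\<^sub>1 \<in> forms_1_0 \<and> \<mu>\<^sub>2 \<in> forms_1_0}"

text \<open>
  The basis \<open>\<omega>\<close> enters only through the volume form, and a change of basis multiplies that
  by \<open>\<bar>det\<bar>\<^sup>2 > 0\<close>.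
\<close>

definition weakly_positive :: "(4 \<Rightarrow> form) \<Rightarrow> form \<Rightarrow> bool" where
  "weakly_positive \<omega> \<Theta> \<longleftrightarrow> real_2_2_form \<Theta> \<and>
     (\<forall>\<psi>\<in>decomposable_2_0. nonneg_4_4 \<omega> (wedge 6 2 (wedge 4 2 \<Theta> \<psi>) (cnj_form \<psi>)))"

text \<open>The index types have arithmetic modulo their size, so the index 6 below is the element 0.\<close>

definition phi :: "(4 \<Rightarrow> form) \<Rightarrow> 6 \<Rightarrow> form" where
  "phi \<omega> j =
     (if j = 1 then wedge 1 1 (\<omega> 1) (\<omega> 2)
      else if j = 2 then wedge 1 1 (\<omega> 1) (\<omega> 3)
      else if j = 3 then wedge 1 1 (\<omega> 1) (\<omega> 4)
      else if j = 4 then wedge 1 1 (\<omega> 2) (\<omega> 3)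
      else if j = 5 then - wedge 1 1 (\<omega> 2) (\<omega> 4)
      else wedge 1 1 (\<omega> 3) (\<omega> 4))"

end

theory Submission
  imports Defs
begin

text \<open>
  Let \<open>\<psi>\<close> be a decomposable \<open>(2,0)\<close>-form. Since forms of degree 2 commute,
  \<open>\<phi>\<^sup>j \<and> cnj \<phi>\<^sup>k \<and> \<psi> \<and> cnj \<psi> = (\<phi>\<^sup>j \<and> \<psi>) \<and> cnj (\<phi>\<^sup>k \<and> \<psi>)\<close>. The signs of the
  \<open>\<phi>\<^sup>j\<close> are chosen so that \<open>\<phi>\<^sup>j \<and> \<phi>\<^sup>k\<close> is \<open>\<omega>\<^sup>1\<^sup>2\<^sup>3\<^sup>4\<close> for \<open>j + k = 7\<close> and zero otherwise, so
  \<open>\<phi>\<^sup>j \<and> \<psi> = y\<^sub>j \<omega>\<^sup>1\<^sup>2\<^sup>3\<^sup>4\<close>, where \<open>y\<^sub>j\<close> is the coefficient of \<open>\<phi>\<^sup>7\<^sup>-\<^sup>j\<close> in \<open>\<psi>\<close>. Hence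
  \<open>\<Theta> \<and> \<psi> \<and> cnj \<psi> = (\<Sum> a\<^sub>j\<^sub>k y\<^sub>j cnj y\<^sub>k) Vol\<close> (\<open>wedge_square_decomposable\<close>). The vectors \<open>y\<close> that
  occur are exactly those on the Pluecker quadric \<open>y\<^sub>1 y\<^sub>6 + y\<^sub>2 y\<^sub>5 + y\<^sub>3 y\<^sub>4 = 0\<close>
  (\<open>pluecker_quadric_decomposable\<close> gives the half used here), and \<open>Vol\<close> does not vanish
  (\<open>Vol_nonzero\<close>). So weak positivity says that \<open>\<Sum> a\<^sub>j\<^sub>k y\<^sub>j cnj y\<^sub>k \<ge> 0\<close> on this quadric.

  What remains is linear algebra (\<open>quadric_bound\<close>). For two of the three pairs, \<open>(j, k)\<close> and
  \<open>(l, m)\<close>, restrict to vectors supported on \<open>{j, k, l, m}\<close> with all four coordinates of modulus 1.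
  The phases of \<open>y\<^sub>j cnj y\<^sub>k\<close> and \<open>y\<^sub>l cnj y\<^sub>m\<close> can be prescribed at will: the equation of the quadric
  then only fixes the phase of one pair relative to the other. Changing the sign of
  \<open>y\<^sub>l\<close> and \<open>y\<^sub>m\<close> and averaging removes all terms that mix the two pairs, and a good choice of the
  two phases leaves \<open>\<bar>a\<^sub>j\<^sub>k\<bar> + \<bar>a\<^sub>l\<^sub>m\<bar> \<le> (a\<^sub>j\<^sub>j + a\<^sub>k\<^sub>k + a\<^sub>l\<^sub>l + a\<^sub>m\<^sub>m) / 2\<close>. Both signs in the theorem follow
  by the triangle inequality, and adding the three instances bounds
  \<open>\<bar>a\<^sub>1\<^sub>6\<bar> + \<bar>a\<^sub>2\<^sub>5\<bar> + \<bar>a\<^sub>3\<^sub>4\<bar>\<close> by half the trace.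
\<close>

section \<open>Alternation and the algebra of the wedge product\<close>

text \<open>
  The wedge product of degrees \<open>p\<close> and \<open>q\<close> is \<open>alt (p + q) (tensor p \<alpha> \<beta>)\<close> divided by \<open>p! q!\<close>.
  Splitting it this way reduces its algebra to the behaviour of iterated alternation, because
  \<open>tensor\<close> is associative on the nose.
\<close>

definition alt :: "nat \<Rightarrow> form \<Rightarrow> form" where
  "alt n F = (\<lambda>v. \<Sum>\<sigma> | \<sigma> permutes {..<n}. of_int (sign \<sigma>) * F (\<lambda>i. v (\<sigma> i)))"

definition tensor :: "nat \<Rightarrow> form \<Rightarrow> form \<Rightarrow> form" where
  "tensor p \<alpha> \<beta> = (\<lambda>v. \<alpha> v * \<beta> (\<lambda>i. v (p + i)))"

text \<open>
  Degrees are not recorded in types, so that a form has degree at most \<open>p\<close> must be carried as a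
  hypothesis. It is weaker than being an alternating \<open>p\<close>-form, and it is what moving arguments past
  a factor requires.
\<close>

definition form_deg :: "nat \<Rightarrow> form \<Rightarrow> bool" where
  "form_deg p \<alpha> \<longleftrightarrow> (\<forall>v w. (\<forall>i<p. v i = w i) \<longrightarrow> \<alpha> v = \<alpha> w)"

lemma form_degD: "form_deg p \<alpha> \<Longrightarrow> (\<And>i. i < p \<Longrightarrow> v i = w i) \<Longrightarrow> \<alpha> v = \<alpha> w"
  unfolding form_deg_def by blast

lemma wedge_eq_alt: "wedge p q \<alpha> \<beta> = (1 / (fact p * fact q)) *\<^sub>F alt (p + q) (tensor p \<alpha> \<beta>)"
  by (simp add: wedge_def scale_form_def alt_def tensor_def mult.assoc)

lemma tensor_assoc: "tensor (p + q) (tensor p \<alpha> \<beta>) \<gamma> = tensor p \<alpha> (tensor q \<beta> \<gamma>)"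
  by (simp add: tensor_def add.assoc mult.assoc)

lemma alt_scale: "alt n (c *\<^sub>F F) = c *\<^sub>F alt n F"
  by (simp add: alt_def scale_form_def sum_distrib_left mult.left_commute)

lemma tensor_scale_left: "tensor p (c *\<^sub>F \<alpha>) \<beta> = c *\<^sub>F tensor p \<alpha> \<beta>"
  and tensor_scale_right: "tensor p \<alpha> (c *\<^sub>F \<beta>) = c *\<^sub>F tensor p \<alpha> \<beta>"
  by (simp_all add: tensor_def scale_form_def mult.assoc mult.left_commute)

text \<open>
  Composition with \<open>\<tau>\<close> on the right permutes the index set of the alternating sum and changes every
  sign by the sign of \<open>\<tau>\<close>.
\<close>

lemma alt_permute:
  assumes "\<tau> permutes {..<n}"
  shows "alt n (\<lambda>v. F (\<lambda>i. v (\<tau> i))) = of_int (sign \<tau>) *\<^sub>F alt n F"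
proof
  fix v
  have \<tau>: "permutation \<tau>" using assms by (auto simp: permutation_permutes)
  have "alt n F v = (\<Sum>\<sigma> | \<sigma> permutes {..<n}. of_int (sign (\<sigma> \<circ> \<tau>)) * F (\<lambda>i. v ((\<sigma> \<circ> \<tau>) i)))"
    unfolding alt_def by (rule sum_permutations_compose_right[OF assms])
  also have "\<dots> = (\<Sum>\<sigma> | \<sigma> permutes {..<n}.
      of_int (sign \<tau>) * (of_int (sign \<sigma>) * F (\<lambda>i. v (\<sigma> (\<tau> i)))))"
    using \<tau> by (intro sum.cong refl)
      (simp add: sign_compose permutes_imp_permutation[of "{..<n}"])
  also have "\<dots> = of_int (sign \<tau>) * alt n (\<lambda>v. F (\<lambda>i. v (\<tau> i))) v"
    by (simp add: alt_def sum_distrib_left)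
  finally show "alt n (\<lambda>v. F (\<lambda>i. v (\<tau> i))) v = (of_int (sign \<tau>) *\<^sub>F alt n F) v"
    by (simp add: scale_form_def mult.assoc [symmetric] flip: of_int_mult)
qed

lemma alt_sum: "alt n (\<lambda>v. \<Sum>i\<in>I. F i v) v = (\<Sum>i\<in>I. alt n (F i) v)"
  unfolding alt_def sum_distrib_left by (rule sum.swap)

lemma alt_mult: "alt n (\<lambda>v. c * F v) v = c * alt n F v"
  by (simp add: alt_def sum_distrib_left mult.left_commute)

lemma of_int_sign_sq: "of_int (sign \<tau>) * (of_int (sign \<tau>) * (x::complex)) = x"
  by (simp add: mult.assoc [symmetric] flip: of_int_mult)

text \<open>
  Alternating in the first \<open>p\<close> arguments before alternating in all of them only contributes the
  factor \<open>p!\<close>: each of the inner permutations fixes the arguments of \<open>\<beta>\<close>, hence is absorbed by the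
  outer sum.
\<close>

lemma alt_tensor_alt_left:
  assumes "p \<le> n"
  shows "alt n (tensor p (alt p \<alpha>) \<beta>) = fact p *\<^sub>F alt n (tensor p \<alpha> \<beta>)"
proof
  fix v
  have eq: "tensor p (alt p \<alpha>) \<beta> =
      (\<lambda>v. \<Sum>\<tau> | \<tau> permutes {..<p}. of_int (sign \<tau>) * tensor p \<alpha> \<beta> (\<lambda>i. v (\<tau> i)))"
  proof
    fix v
    have "\<beta> (\<lambda>i. v (\<tau> (p + i))) = \<beta> (\<lambda>i. v (p + i))" if "\<tau> permutes {..<p}" for \<tau>
      using permutes_not_in[OF that] by simp
    then show "tensor p (alt p \<alpha>) \<beta> v =
        (\<Sum>\<tau> | \<tau> permutes {..<p}. of_int (sign \<tau>) * tensor p \<alpha> \<beta> (\<lambda>i. v (\<tau> i)))"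
      by (simp add: tensor_def alt_def sum_distrib_right mult.assoc)
  qed
  have "alt n (tensor p (alt p \<alpha>) \<beta>) v =
      (\<Sum>\<tau> | \<tau> permutes {..<p}. of_int (sign \<tau>) * alt n (\<lambda>v. tensor p \<alpha> \<beta> (\<lambda>i. v (\<tau> i))) v)"
    unfolding eq alt_sum alt_mult ..
  also have "\<dots> = (\<Sum>\<tau> | \<tau> permutes {..<p}. alt n (tensor p \<alpha> \<beta>) v)"
  proof (intro sum.cong refl)
    fix \<tau> assume "\<tau> \<in> {\<tau>. \<tau> permutes {..<p}}"
    then have "\<tau> permutes {..<n}" using assms by (auto intro: permutes_subset)
    from alt_permute[OF this, of "tensor p \<alpha> \<beta>"]
    show "of_int (sign \<tau>) * alt n (\<lambda>v. tensor p \<alpha> \<beta> (\<lambda>i. v (\<tau> i))) v = alt n (tensor p \<alpha> \<beta>) v"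
      by (simp add: scale_form_def of_int_sign_sq)
  qed
  also have "\<dots> = fact p * alt n (tensor p \<alpha> \<beta>) v"
    by (simp add: card_permutations[of _ p])
  finally show "alt n (tensor p (alt p \<alpha>) \<beta>) v = (fact p *\<^sub>F alt n (tensor p \<alpha> \<beta>)) v"
    by (simp add: scale_form_def)
qed

text \<open>
  For the last \<open>q\<close> arguments the inner permutations have to be shifted by \<open>p\<close> first. The shifted
  permutations fix the positions below \<open>p\<close>, and \<open>\<alpha>\<close> sees no other ones.
\<close>

lemma alt_tensor_alt_right:
  assumes "form_deg p \<alpha>"
  shows "alt (p + q) (tensor p \<alpha> (alt q \<beta>)) = fact q *\<^sub>F alt (p + q) (tensor p \<alpha> \<beta>)"
proof
  fix v
  define shift where "shift = map_permutation {..<q} ((+) p)"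
  have shift_ge: "shift \<tau> (p + i) = p + \<tau> i" if "\<tau> permutes {..<q}" for \<tau> i
  proof (cases "i < q")
    case True then show ?thesis unfolding shift_def by (subst map_permutation_apply) auto
  next
    case False then show ?thesis
      using permutes_not_in[OF that] by (auto simp: shift_def map_permutation_def restrict_id_def)
  qed
  have shift_less: "shift \<tau> i = i" if "i < p" for \<tau> i
    using that by (auto simp: shift_def map_permutation_def restrict_id_def)
  have shift_perm: "shift \<tau> permutes {..<p + q}" if "\<tau> permutes {..<q}" for \<tau>
    unfolding shift_def
    by (rule permutes_subset[OF map_permutation_permutes[OF _ that]]) (auto intro: bij_betwI')
  have shift_sign: "sign (shift \<tau>) = sign \<tau>" if "\<tau> permutes {..<q}" for \<tau>
    unfolding shift_def by (rule sign_map_permutation) (use that in auto)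
  have eq: "tensor p \<alpha> (alt q \<beta>) =
      (\<lambda>v. \<Sum>\<tau> | \<tau> permutes {..<q}. of_int (sign \<tau>) * tensor p \<alpha> \<beta> (\<lambda>i. v (shift \<tau> i)))"
  proof
    fix v
    have "\<alpha> (\<lambda>i. v (shift \<tau> i)) = \<alpha> v" for \<tau>
      by (rule form_degD[OF assms]) (simp add: shift_less)
    then show "tensor p \<alpha> (alt q \<beta>) v =
        (\<Sum>\<tau> | \<tau> permutes {..<q}. of_int (sign \<tau>) * tensor p \<alpha> \<beta> (\<lambda>i. v (shift \<tau> i)))"
      by (simp add: tensor_def alt_def sum_distrib_left shift_ge mult.left_commute)
  qed
  have "alt (p + q) (tensor p \<alpha> (alt q \<beta>)) v =
      (\<Sum>\<tau> | \<tau> permutes {..<q}.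
        of_int (sign \<tau>) * alt (p + q) (\<lambda>v. tensor p \<alpha> \<beta> (\<lambda>i. v (shift \<tau> i))) v)"
    unfolding eq alt_sum alt_mult ..
  also have "\<dots> = (\<Sum>\<tau> | \<tau> permutes {..<q}. alt (p + q) (tensor p \<alpha> \<beta>) v)"
  proof (intro sum.cong refl)
    fix \<tau> assume "\<tau> \<in> {\<tau>. \<tau> permutes {..<q}}"
    then have \<tau>: "\<tau> permutes {..<q}" by simp
    show "of_int (sign \<tau>) * alt (p + q) (\<lambda>v. tensor p \<alpha> \<beta> (\<lambda>i. v (shift \<tau> i))) v =
        alt (p + q) (tensor p \<alpha> \<beta>) v"
      by (simp add: alt_permute[OF shift_perm[OF \<tau>], of "tensor p \<alpha> \<beta>"] scale_form_def
          of_int_sign_sq shift_sign[OF \<tau>])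
  qed
  also have "\<dots> = fact q * alt (p + q) (tensor p \<alpha> \<beta>) v"
    by (simp add: card_permutations[of _ q])
  finally show "alt (p + q) (tensor p \<alpha> (alt q \<beta>)) v = (fact q *\<^sub>F alt (p + q) (tensor p \<alpha> \<beta>)) v"
    by (simp add: scale_form_def)
qed

text \<open>
  Both sides are the alternation of \<open>\<alpha> \<otimes> \<beta> \<otimes> \<gamma>\<close> divided by \<open>p! q! r!\<close>.
\<close>

lemma wedge_assoc:
  assumes "form_deg p \<alpha>"
  shows "wedge (p + q) r (wedge p q \<alpha> \<beta>) \<gamma> = wedge p (q + r) \<alpha> (wedge q r \<beta> \<gamma>)"
proof -
  let ?c = "1 / (fact p * fact q * fact r) :: complex"
  have "wedge (p + q) r (wedge p q \<alpha> \<beta>) \<gamma> =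
      ?c *\<^sub>F alt (p + q + r) (tensor (p + q) (tensor p \<alpha> \<beta>) \<gamma>)"
    by (simp add: wedge_eq_alt tensor_scale_left alt_scale alt_tensor_alt_left)
  also have "\<dots> = ?c *\<^sub>F alt (p + (q + r)) (tensor p \<alpha> (tensor q \<beta> \<gamma>))"
    by (simp add: tensor_assoc add.assoc)
  also have "\<dots> = wedge p (q + r) \<alpha> (wedge q r \<beta> \<gamma>)"
    by (simp add: wedge_eq_alt tensor_scale_right alt_scale alt_tensor_alt_right[OF assms])
  finally show ?thesis .
qed

text \<open>
  Graded commutativity, with the sign left as that of the permutation \<open>\<rho>\<close> which exchanges the two
  blocks of arguments; it is evaluated for the two degrees of interest below.
\<close>

lemma wedge_block_swap:
  assumes "\<rho> permutes {..<p + q}" "\<And>i. i < q \<Longrightarrow> \<rho> i = p + i" "\<And>i. i < p \<Longrightarrow> \<rho> (q + i) = i"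
    and "form_deg p \<alpha>" "form_deg q \<beta>"
  shows "wedge p q \<alpha> \<beta> = of_int (sign \<rho>) *\<^sub>F wedge q p \<beta> \<alpha>"
proof -
  have "tensor p \<alpha> \<beta> = (\<lambda>v. tensor q \<beta> \<alpha> (\<lambda>i. v (\<rho> i)))"
  proof
    fix v
    have "\<beta> (\<lambda>i. v (\<rho> i)) = \<beta> (\<lambda>i. v (p + i))" "\<alpha> (\<lambda>i. v (\<rho> (q + i))) = \<alpha> v"
      by (rule form_degD[OF assms(5)] form_degD[OF assms(4)]; simp add: assms)+
    then show "tensor p \<alpha> \<beta> v = tensor q \<beta> \<alpha> (\<lambda>i. v (\<rho> i))"
      by (simp add: tensor_def)
  qed
  then show ?thesis
    by (simp add: wedge_eq_alt alt_permute[OF assms(1)] add.commute[of q p] mult.commute)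
qed

lemma wedge_1_1_anticommute:
  assumes "form_deg 1 \<alpha>" "form_deg 1 \<beta>"
  shows "wedge 1 1 \<alpha> \<beta> = - wedge 1 1 \<beta> \<alpha>"
proof -
  have "wedge 1 1 \<alpha> \<beta> = of_int (sign (Transposition.transpose (0::nat) 1)) *\<^sub>F wedge 1 1 \<beta> \<alpha>"
    by (rule wedge_block_swap) (use assms in \<open>auto intro!: permutes_swap_id\<close>)
  then show ?thesis by (simp add: sign_swap_id)
qed

lemma wedge_2_2_commute:
  assumes "form_deg 2 \<alpha>" "form_deg 2 \<beta>"
  shows "wedge 2 2 \<alpha> \<beta> = wedge 2 2 \<beta> \<alpha>"
proof -
  define \<rho> where "\<rho> = Transposition.transpose (0::nat) 2 \<circ> Transposition.transpose 1 3"
  have less_2: "i < 2 \<longleftrightarrow> i = 0 \<or> i = (1::nat)" for i by auto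
  have "wedge 2 2 \<alpha> \<beta> = of_int (sign \<rho>) *\<^sub>F wedge 2 2 \<beta> \<alpha>"
    by (rule wedge_block_swap)
      (use assms in \<open>auto simp: \<rho>_def less_2 Transposition.transpose_def intro!: permutes_compose permutes_swap_id\<close>)
  moreover have "sign \<rho> = 1"
    unfolding \<rho>_def by (subst sign_compose) (auto simp: sign_swap_id permutation_swap_id)
  ultimately show ?thesis by simp
qed

lemma form_deg_wedge:
  assumes "form_deg p \<alpha>" "form_deg q \<beta>"
  shows "form_deg (p + q) (wedge p q \<alpha> \<beta>)"
  unfolding form_deg_def
proof (intro allI impI)
  fix v w :: "nat \<Rightarrow> complex^4" assume vw: "\<forall>i<p + q. v i = w i"
  have "\<alpha> (\<lambda>i. v (\<sigma> i)) = \<alpha> (\<lambda>i. w (\<sigma> i)) \<and> \<beta> (\<lambda>i. v (\<sigma> (p + i))) = \<beta> (\<lambda>i. w (\<sigma> (p + i)))"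
    if "\<sigma> permutes {..<p + q}" for \<sigma>
  proof -
    have "v (\<sigma> i) = w (\<sigma> i)" if "i < p + q" for i
      using vw permutes_in_image[OF \<open>\<sigma> permutes _\<close>, of i] that by auto
    then show ?thesis
      by (auto intro!: form_degD[OF assms(1)] form_degD[OF assms(2)])
  qed
  then show "wedge p q \<alpha> \<beta> v = wedge p q \<alpha> \<beta> w"
    by (simp add: wedge_def)
qed

lemma wedge_scale_left: "wedge p q (c *\<^sub>F \<alpha>) \<beta> = c *\<^sub>F wedge p q \<alpha> \<beta>"
  and wedge_scale_right: "wedge p q \<alpha> (c *\<^sub>F \<beta>) = c *\<^sub>F wedge p q \<alpha> \<beta>"
  by (simp_all add: wedge_eq_alt tensor_scale_left tensor_scale_right alt_scale mult.commute)

lemma wedge_add_left: "wedge p q (\<alpha> + \<alpha>') \<beta> = wedge p q \<alpha> \<beta> + wedge p q \<alpha>' \<beta>"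
  and wedge_add_right: "wedge p q \<alpha> (\<beta> + \<beta>') = wedge p q \<alpha> \<beta> + wedge p q \<alpha> \<beta>'"
  by (simp_all add: wedge_def fun_eq_iff algebra_simps sum.distrib add_divide_distrib)

lemma wedge_minus_left: "wedge p q (- \<alpha>) \<beta> = - wedge p q \<alpha> \<beta>"
  and wedge_minus_right: "wedge p q \<alpha> (- \<beta>) = - wedge p q \<alpha> \<beta>"
  using wedge_scale_left[of p q "- 1" \<alpha> \<beta>] wedge_scale_right[of p q \<alpha> "- 1" \<beta>] by simp_all

lemma wedge_zero_left: "wedge p q 0 \<beta> = 0"
  and wedge_zero_right: "wedge p q \<alpha> 0 = 0"
  by (simp_all add: wedge_def fun_eq_iff)

lemma wedge_sum_left: "wedge p q (\<Sum>i\<in>I. f i) \<beta> = (\<Sum>i\<in>I. wedge p q (f i) \<beta>)"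
  by (induction I rule: infinite_finite_induct) (simp_all only: sum.infinite sum.empty sum.insert wedge_zero_left wedge_add_left not_False_eq_True)

lemma wedge_sum_right: "wedge p q \<alpha> (\<Sum>i\<in>I. f i) = (\<Sum>i\<in>I. wedge p q \<alpha> (f i))"
  by (induction I rule: infinite_finite_induct) (simp_all only: sum.infinite sum.empty sum.insert wedge_zero_right wedge_add_right not_False_eq_True)

lemma cnj_wedge: "cnj_form (wedge p q \<alpha> \<beta>) = wedge p q (cnj_form \<alpha>) (cnj_form \<beta>)"
  by (simp add: wedge_def cnj_form_def)

lemma wedge_self:
  assumes "form_deg 1 \<alpha>"
  shows "wedge 1 1 \<alpha> \<alpha> = 0"
proof
  fix v
  have "wedge 1 1 \<alpha> \<alpha> v = - wedge 1 1 \<alpha> \<alpha> v"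
    using fun_cong[OF wedge_1_1_anticommute[OF assms assms], of v] by simp
  then show "wedge 1 1 \<alpha> \<alpha> v = 0 v" by simp
qed

text \<open>
  Exchanging \<open>\<beta>\<close> and \<open>\<gamma>\<close> collects \<open>\<phi>\<^sup>j\<close> with \<open>\<psi>\<close> and \<open>cnj \<phi>\<^sup>k\<close> with \<open>cnj \<psi>\<close> in
  \<open>\<phi>\<^sup>j \<and> cnj \<phi>\<^sup>k \<and> \<psi> \<and> cnj \<psi>\<close>.
\<close>

lemma wedge_four_2_forms:
  assumes "form_deg 2 \<alpha>" "form_deg 2 \<beta>" "form_deg 2 \<gamma>"
  shows "wedge 6 2 (wedge 4 2 (wedge 2 2 \<alpha> \<beta>) \<gamma>) \<delta> =
    wedge 4 4 (wedge 2 2 \<alpha> \<gamma>) (wedge 2 2 \<beta> \<delta>)"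
proof -
  have assoc: "wedge 4 2 (wedge 2 2 \<alpha> \<beta>') \<gamma>' = wedge 2 4 \<alpha> (wedge 2 2 \<beta>' \<gamma>')" for \<beta>' \<gamma>'
    using wedge_assoc[OF assms(1), of 2 2] by simp
  have "wedge 4 2 (wedge 2 2 \<alpha> \<beta>) \<gamma> = wedge 4 2 (wedge 2 2 \<alpha> \<gamma>) \<beta>"
    by (simp add: assoc wedge_2_2_commute[OF assms(2,3)])
  moreover have "form_deg 4 (wedge 2 2 \<alpha> \<gamma>)"
    using form_deg_wedge[OF assms(1,3)] by simp
  ultimately show ?thesis
    using wedge_assoc[of 4 "wedge 2 2 \<alpha> \<gamma>" 2 2 \<beta> \<delta>] by simp
qed

lemma form_deg_uminus: "form_deg p \<alpha> \<Longrightarrow> form_deg p (- \<alpha>)"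
  unfolding form_deg_def by (auto intro: arg_cong[of _ _ uminus])

lemma form_deg_1_0: "\<mu> \<in> forms_1_0 \<Longrightarrow> form_deg 1 \<mu>"
  by (auto simp: forms_1_0_def form_deg_def)

lemma form_deg_cnj: "form_deg p \<alpha> \<Longrightarrow> form_deg p (cnj_form \<alpha>)"
  unfolding form_deg_def cnj_form_def by (auto intro: arg_cong[of _ _ cnj])

lemma cnj_wedge_list: "cnj_form (wedge_list \<mu>s) = wedge_list (map cnj_form \<mu>s)"
  by (induction \<mu>s) (simp_all add: cnj_wedge, simp add: cnj_form_def)

lemma cnj_scale_form: "cnj_form (c *\<^sub>F \<alpha>) = cnj c *\<^sub>F cnj_form \<alpha>"
  by (simp add: cnj_form_def scale_form_def)

section \<open>Wedge products of lists of 1-forms\<close>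

lemma wedge_1_0_one: "wedge 1 0 \<mu> (\<lambda>v. 1) = \<mu>"
  by (simp add: wedge_def lessThan_Suc)

lemma wedge_list_two: "wedge_list [\<alpha>, \<beta>] = wedge 1 1 \<alpha> \<beta>"
  using wedge_1_0_one by simp

lemma wedge_list_append:
  assumes "length \<mu>s = p" "length \<nu>s = q" "0 < p" "\<And>\<mu>. \<mu> \<in> set \<mu>s \<Longrightarrow> form_deg 1 \<mu>"
  shows "wedge p q (wedge_list \<mu>s) (wedge_list \<nu>s) = wedge_list (\<mu>s @ \<nu>s)"
proof -
  have "\<mu>s \<noteq> []" using assms by auto
  then have "wedge (length \<mu>s) (length \<nu>s) (wedge_list \<mu>s) (wedge_list \<nu>s) = wedge_list (\<mu>s @ \<nu>s)"
    using assms(4)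
  proof (induction \<mu>s rule: list_nonempty_induct)
    case (single \<mu>)
    show ?case using wedge_1_0_one by simp
  next
    case (cons \<mu> \<mu>s)
    then show ?case
      using wedge_assoc[of 1 \<mu> "length \<mu>s" "length \<nu>s" "wedge_list \<mu>s" "wedge_list \<nu>s"] by simp
  qed
  then show ?thesis unfolding assms .
qed

lemma wedge_list_swap:
  assumes "form_deg 1 \<alpha>" "form_deg 1 \<beta>"
  shows "wedge_list (\<mu>s @ \<alpha> # \<beta> # \<nu>s) = - wedge_list (\<mu>s @ \<beta> # \<alpha> # \<nu>s)"
proof (induction \<mu>s)
  case Nil
  let ?n = "length \<nu>s"
  have "wedge_list (\<alpha> # \<beta> # \<nu>s) = wedge (1 + 1) ?n (wedge 1 1 \<alpha> \<beta>) (wedge_list \<nu>s)"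
    by (subst wedge_assoc[OF assms(1)]) simp
  also have "\<dots> = - wedge (1 + 1) ?n (wedge 1 1 \<beta> \<alpha>) (wedge_list \<nu>s)"
    using wedge_1_1_anticommute[OF assms] by (simp only: wedge_minus_left)
  also have "wedge (1 + 1) ?n (wedge 1 1 \<beta> \<alpha>) (wedge_list \<nu>s) = wedge_list (\<beta> # \<alpha> # \<nu>s)"
    by (subst wedge_assoc[OF assms(2)]) simp
  finally show ?case by simp
next
  case (Cons \<mu> \<mu>s)
  then show ?case
    by (simp only: append_Cons wedge_list.simps wedge_minus_right length_append length_Cons)
qed

lemma wedge_list_repeat:
  assumes "form_deg 1 \<alpha>"
  shows "wedge_list (\<mu>s @ \<alpha> # \<alpha> # \<nu>s) = 0"
proof
  fix v
  have "wedge_list (\<mu>s @ \<alpha> # \<alpha> # \<nu>s) v = - wedge_list (\<mu>s @ \<alpha> # \<alpha> # \<nu>s) v"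
    using fun_cong[OF wedge_list_swap[OF assms assms], of \<mu>s \<nu>s v] by simp
  then show "wedge_list (\<mu>s @ \<alpha> # \<alpha> # \<nu>s) v = 0 v" by simp
qed

section \<open>The volume form does not vanish\<close>

text \<open>
  The Leibniz formula, for matrices indexed by natural numbers. The first index of \<open>M\<close> is the column,
  so that a column is replaced by a function update.
\<close>

definition perm_det :: "nat \<Rightarrow> (nat \<Rightarrow> nat \<Rightarrow> complex) \<Rightarrow> complex" where
  "perm_det n M = (\<Sum>\<sigma> | \<sigma> permutes {..<n}. of_int (sign \<sigma>) * (\<Prod>i<n. M (\<sigma> i) i))"

lemma wedge_list_eq_perm_det:
  assumes "\<And>\<mu>. \<mu> \<in> set \<mu>s \<Longrightarrow> form_deg 1 \<mu>"
  shows "wedge_list \<mu>s v = perm_det (length \<mu>s) (\<lambda>j i. (\<mu>s ! i) (\<lambda>_. v j))"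
proof -
  have "wedge_list \<mu>s = alt (length \<mu>s) (\<lambda>v. \<Prod>i<length \<mu>s. (\<mu>s ! i) (\<lambda>_. v i))"
    using assms
  proof (induction \<mu>s)
    case Nil
    show ?case by (simp add: alt_def)
  next
    case (Cons \<mu> \<mu>s)
    let ?n = "length \<mu>s"
    let ?F = "\<lambda>v. \<Prod>i<?n. (\<mu>s ! i) (\<lambda>_. v i)"
    have \<mu>: "form_deg 1 \<mu>" using Cons.prems by simp
    have "\<mu> v = \<mu> (\<lambda>_. v 0)" for v by (rule form_degD[OF \<mu>]) simp
    then have split: "tensor 1 \<mu> ?F = (\<lambda>v. \<Prod>i<length (\<mu> # \<mu>s). ((\<mu> # \<mu>s) ! i) (\<lambda>_. v i))"
      by (simp add: tensor_def fun_eq_iff prod.lessThan_Suc_shift del: prod.lessThan_Suc)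
    have "wedge_list (\<mu> # \<mu>s) = wedge 1 ?n \<mu> (alt ?n ?F)"
      using Cons.IH Cons.prems by simp
    also have "\<dots> = alt (1 + ?n) (tensor 1 \<mu> ?F)"
      using alt_tensor_alt_right[OF \<mu>, of ?n ?F] by (simp add: wedge_eq_alt)
    finally show ?case unfolding split by simp
  qed
  then show ?thesis by (simp add: alt_def perm_det_def)
qed

lemma perm_det_cong:
  assumes "\<And>j i. j < n \<Longrightarrow> i < n \<Longrightarrow> M j i = N j i"
  shows "perm_det n M = perm_det n N"
proof -
  have "(\<Prod>i<n. M (\<sigma> i) i) = (\<Prod>i<n. N (\<sigma> i) i)" if "\<sigma> permutes {..<n}" for \<sigma>
    using permutes_in_image[OF that] by (intro prod.cong refl assms) auto
  then show ?thesis by (simp add: perm_det_def)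
qed

lemma perm_det_linear_column:
  assumes "k < n"
  shows "perm_det n (M(k := \<lambda>i. a * f i + b * g i)) =
    a * perm_det n (M(k := f)) + b * perm_det n (M(k := g))"
proof -
  have split: "(\<Prod>i<n. (M(k := h)) (\<sigma> i) i) = h (inv \<sigma> k) * (\<Prod>i\<in>{..<n} - {inv \<sigma> k}. M (\<sigma> i) i)"
    if \<sigma>: "\<sigma> permutes {..<n}" for \<sigma> and h :: "nat \<Rightarrow> complex"
  proof -
    have "inv \<sigma> k < n"
      using permutes_in_image[OF permutes_inv[OF \<sigma>], of k] assms by simp
    moreover have "\<sigma> (inv \<sigma> k) = k" by (rule permutes_inverses(1)[OF \<sigma>])
    moreover have "\<sigma> i \<noteq> k" if "i \<noteq> inv \<sigma> k" for i
      using that permutes_inverses(2)[OF \<sigma>] by metis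
    ultimately show ?thesis
      by (subst prod.remove[of _ "inv \<sigma> k"]) (auto intro!: prod.cong)
  qed
  show ?thesis
    unfolding perm_det_def sum_distrib_left sum.distrib [symmetric]
    by (intro sum.cong refl) (simp only: mem_Collect_eq split, simp add: algebra_simps)
qed

lemma perm_det_identity: "perm_det n (\<lambda>j i. if i = j then 1 else 0) = 1"
proof -
  have "(\<Prod>i<n. if i = \<sigma> i then 1 else 0 :: complex) = (if \<sigma> = id then 1 else 0)"
    if \<sigma>: "\<sigma> permutes {..<n}" for \<sigma>
  proof (cases "\<sigma> = id")
    case False
    then obtain i where "\<sigma> i \<noteq> i" by (auto simp: fun_eq_iff)
    moreover from this have "i < n" using permutes_not_in[OF \<sigma>, of i] by auto
    ultimately show ?thesis using False by auto
  qed simp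
  then have "perm_det n (\<lambda>j i. if i = j then 1 else 0) =
      (\<Sum>\<sigma> | \<sigma> permutes {..<n}. if \<sigma> = id then 1 else 0)"
    unfolding perm_det_def by (intro sum.cong refl) simp
  also have "\<dots> = 1"
    using permutes_id[of "{..<n}"] by (subst sum.delta) (auto simp: finite_permutations)
  finally show ?thesis .
qed

text \<open>
  Only columns of the form \<open>F x\<close> are available, and the unit columns need not be among them. But
  starting from the identity matrix, each unit column is a combination of two available ones, so
  by linearity in that column one of the two can be put in its place without making the determinant
  vanish.
\<close>

lemma perm_det_nonzero:
  assumes units: "\<And>k. k < n \<Longrightarrow>
      \<exists>a b x y. \<forall>i<n. a * F x i + b * F y i = (if i = k then 1 else 0)"
  shows "\<exists>x. perm_det n (\<lambda>j. F (x j)) \<noteq> 0"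
proof -
  let ?unit = "\<lambda>j i. if i = j then 1 else 0 :: complex"
  have "\<exists>x. perm_det n (\<lambda>j. if j < m then F (x j) else ?unit j) \<noteq> 0" if "m \<le> n" for m
    using that
  proof (induction m)
    case 0
    show ?case by (simp add: perm_det_identity)
  next
    case (Suc m)
    then obtain x where x: "perm_det n (\<lambda>j. if j < m then F (x j) else ?unit j) \<noteq> 0"
      by auto
    define M where "M = (\<lambda>j. if j < m then F (x j) else ?unit j)"
    obtain a b p q where pq: "\<forall>i<n. a * F p i + b * F q i = ?unit m i"
      using units[of m] Suc.prems by (meson Suc_le_lessD)
    have "perm_det n M = perm_det n (M(m := \<lambda>i. a * F p i + b * F q i))"
      by (rule perm_det_cong) (use pq in \<open>auto simp: M_def\<close>)
    also have "\<dots> = a * perm_det n (M(m := F p)) + b * perm_det n (M(m := F q))"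
      by (rule perm_det_linear_column) (use Suc.prems in simp)
    finally obtain y where y: "perm_det n (M(m := F y)) \<noteq> 0"
      using x unfolding M_def [symmetric] by force
    have "M(m := F y) = (\<lambda>j. if j < Suc m then F ((x(m := y)) j) else ?unit j)"
      by (rule ext) (simp add: M_def less_Suc_eq)
    with y show ?case by (intro exI[of _ "x(m := y)"]) simp
  qed
  from this[of n] obtain x where "perm_det n (\<lambda>j. if j < n then F (x j) else ?unit j) \<noteq> 0"
    by auto
  also have "perm_det n (\<lambda>j. if j < n then F (x j) else ?unit j) = perm_det n (\<lambda>j. F (x j))"
    by (rule perm_det_cong) simp
  finally show ?thesis by blast
qed

lemma basis_in_forms: "basis_1_0 \<omega> \<Longrightarrow> \<omega> i \<in> forms_1_0"
  unfolding basis_1_0_def by (metis form.span_base rangeI)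

lemma sum_scale_in_forms:
  assumes "basis_1_0 \<omega>"
  shows "(\<Sum>i\<in>UNIV. c i *\<^sub>F \<omega> i) \<in> forms_1_0"
proof -
  have "(\<Sum>i\<in>UNIV. c i *\<^sub>F \<omega> i) \<in> form.span (range \<omega>)"
    by (intro form.span_sum form.span_scale form.span_base) simp
  then show ?thesis using assms by (simp add: basis_1_0_def)
qed

lemma sum_form_apply: "(\<Sum>i\<in>I. f i) v = (\<Sum>i\<in>I. (f i :: form) v)"
  by (induction I rule: infinite_finite_induct) auto

text \<open>
  The coordinate functionals lie in the span of \<open>\<omega>\<close>, which provides a left inverse of the matrix
  of \<open>\<omega>\<close>. A left inverse of a square matrix is a right inverse, and its columns are the dual basis.
  The scalar \<open>c\<close> is there because the volume form is evaluated on both \<open>e j\<close> and \<open>\<i> e j\<close>.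
\<close>

lemma dual_basis:
  assumes "basis_1_0 \<omega>"
  obtains e :: "4 \<Rightarrow> complex^4"
  where "\<And>i j c. \<omega> i (\<lambda>_. c *s e j) = (if i = j then c else 0)"
proof -
  have "\<exists>f. Vector_Spaces.linear (*s) (*) f \<and> \<omega> i = (\<lambda>v. f (v 0))" for i
    using basis_in_forms[OF assms, of i] by (simp add: forms_1_0_def)
  then obtain f where f: "\<And>i. Vector_Spaces.linear (*s) (*) (f i)"
    and \<omega>: "\<And>i. \<omega> i = (\<lambda>v. f i (v 0))" by metis
  have f_scale: "f i (c *s x) = c * f i x" for i c x
    using f[of i] by (rule module_hom.scale[OF module_hom_linearI])
  have f_sum: "f i (\<Sum>k\<in>UNIV. g k) = (\<Sum>k\<in>UNIV. f i (g k))" for i and g :: "4 \<Rightarrow> complex^4"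
    using f[of i] by (rule module_hom.sum[OF module_hom_linearI])
  define B :: "complex^4^4" where "B = (\<chi> i k. f i (axis k 1))"
  have f_B: "f i x = (\<Sum>k\<in>UNIV. B $ i $ k * x $ k)" for i x
  proof -
    have "f i x = f i (\<Sum>k\<in>UNIV. x $ k *s axis k 1)" by (simp add: basis_expansion)
    then show ?thesis by (simp add: f_sum f_scale B_def mult.commute)
  qed
  have "\<exists>u. \<forall>x. x $ k = (\<Sum>i\<in>UNIV. u i * f i x)" for k
  proof -
    have "Vector_Spaces.linear (*s) (*) (\<lambda>x :: complex^4. x $ k)"
      by unfold_locales (simp_all add: algebra_simps)
    then have "(\<lambda>v. v 0 $ k) \<in> forms_1_0" unfolding forms_1_0_def by blast
    then have "(\<lambda>v. v 0 $ k) \<in> form.span (range \<omega>)" using assms by (simp add: basis_1_0_def)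
    then obtain u where "(\<lambda>v. v 0 $ k) = (\<Sum>\<mu>\<in>range \<omega>. u \<mu> *\<^sub>F \<mu>)"
      by (auto simp: form.span_finite)
    then have u: "(\<lambda>v. v 0 $ k) = (\<Sum>i\<in>UNIV. u (\<omega> i) *\<^sub>F \<omega> i)"
      using assms by (simp add: sum.reindex basis_1_0_def)
    have "x $ k = (\<Sum>i\<in>UNIV. u (\<omega> i) * f i x)" for x
      using fun_cong[OF u, of "\<lambda>_. x"] by (simp add: sum_form_apply scale_form_def \<omega>)
    then show ?thesis by auto
  qed
  then obtain u where u: "\<And>k x. x $ k = (\<Sum>i\<in>UNIV. u k i * f i x)" by metis
  define C :: "complex^4^4" where "C = (\<chi> k i. u k i)"
  have "(C ** B) $ k $ j = axis j 1 $ k" for k j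
    unfolding u[of "axis j 1" k] by (simp add: matrix_matrix_mult_def C_def B_def)
  then have "C ** B = mat 1"
    by (simp add: vec_eq_iff mat_def axis_def)
  then have BC: "B ** C = mat 1" by (simp add: matrix_left_right_inverse)
  have "\<omega> i (\<lambda>_. c *s column j C) = (if i = j then c else 0)" for i j c
  proof -
    have "f i (column j C) = (B ** C) $ i $ j"
      by (simp add: f_B matrix_matrix_mult_def column_def)
    then show ?thesis unfolding BC by (simp add: \<omega> f_scale mat_def)
  qed
  then show ?thesis by (rule that)
qed

text \<open>
  The functionals \<open>\<omega>\<^sup>i\<close> and \<open>cnj \<omega>\<^sup>i\<close> take the values 1 and 1 on \<open>e i\<close>, but \<open>\<i>\<close> and \<open>- \<i>\<close> on
  \<open>\<i> e i\<close>. So every unit column is a complex combination of the columns of these two vectors, which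
  is what \<open>perm_det_nonzero\<close> asks for.
\<close>

lemma Vol_nonzero:
  assumes "basis_1_0 \<omega>"
  shows "\<exists>v. Vol \<omega> v \<noteq> 0"
proof -
  obtain e where e: "\<And>i j c. \<omega> i (\<lambda>_. c *s e j) = (if i = j then c else 0)"
    using dual_basis[OF assms] by blast
  have e_1: "\<omega> i (\<lambda>_. e j) = (if i = j then 1 else 0)" for i j
    using e[of i 1 j] by simp
  let ?\<mu>s = "[\<omega> 1, \<omega> 2, \<omega> 3, \<omega> 4,
     cnj_form (\<omega> 1), cnj_form (\<omega> 2), cnj_form (\<omega> 3), cnj_form (\<omega> 4)]"
  let ?F = "\<lambda>x i. (?\<mu>s ! i) (\<lambda>_. x)"
  have deg: "form_deg 1 \<mu>" if "\<mu> \<in> set ?\<mu>s" for \<mu>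
    using that form_deg_1_0[OF basis_in_forms[OF assms]] by (auto intro: form_deg_cnj simp del: One_nat_def)
  have all_8: "(\<forall>i<8. P i) \<longleftrightarrow> P 0 \<and> P 1 \<and> P 2 \<and> P 3 \<and> P 4 \<and> P 5 \<and> P 6 \<and> P 7"
    for P :: "nat \<Rightarrow> bool"
    by (simp add: numeral_eq_Suc All_less_Suc) blast
  have combos: "\<forall>k<8. \<exists>a b x y. \<forall>i<8. a * ?F x i + b * ?F y i = (if i = k then 1 else 0)"
  proof -
    define j where "j k = [1, 2, 3, 4, 1, 2, 3, 4 :: 4] ! k" for k
    \<comment> \<open>\<open>(1 / 2) e - (\<i> / 2) (\<i> e)\<close> keeps the linear part, the other sign the antilinear part.\<close>
    define s where "s k = (if k < 4 then - \<i> / 2 else \<i> / 2)" for k :: nat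
    have "\<forall>k<8. \<forall>i<8. 1 / 2 * ?F (e (j k)) i + s k * ?F (\<i> *s e (j k)) i = (if i = k then 1 else 0)"
      unfolding all_8 by (simp add: j_def s_def cnj_form_def e e_1)
    then show ?thesis by blast
  qed
  obtain x where "perm_det 8 (\<lambda>j. ?F (x j)) \<noteq> 0"
    using perm_det_nonzero[of 8 ?F] combos by blast
  moreover have "length ?\<mu>s = 8" by simp
  ultimately have "Vol \<omega> x \<noteq> 0"
    unfolding Vol_def using wedge_list_eq_perm_det[of ?\<mu>s x, OF deg] by (simp only: not_False_eq_True)
  then show ?thesis by blast
qed

section \<open>Decomposable 2-forms and the Pluecker quadric\<close>

lemma exhaust_6: "(x::6) = 1 \<or> x = 2 \<or> x = 3 \<or> x = 4 \<or> x = 5 \<or> x = 6"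
proof (induct x)
  case (of_int z)
  then have "z = 0 \<or> z = 1 \<or> z = 2 \<or> z = 3 \<or> z = 4 \<or> z = 5" by fastforce
  then show ?case by auto
qed

lemma UNIV_6: "UNIV = {1, 2, 3, 4, 5, 6 :: 6}"
  using exhaust_6 by auto

text \<open>
  The coordinates \<open>y\<^sub>j\<close> for which \<open>\<phi>\<^sup>j \<and> \<mu>\<^sub>1 \<and> \<mu>\<^sub>2 = y\<^sub>j \<omega>\<^sup>1\<^sup>2\<^sup>3\<^sup>4\<close> when \<open>c\<close> and \<open>d\<close> are the coefficient
  vectors of \<open>\<mu>\<^sub>1\<close> and \<open>\<mu>\<^sub>2\<close>: up to order and sign, the \<open>2\<times>2\<close> minors of the matrix with rows \<open>c\<close> and
  \<open>d\<close>.
\<close>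

definition dual_pluecker :: "(4 \<Rightarrow> complex) \<Rightarrow> (4 \<Rightarrow> complex) \<Rightarrow> 6 \<Rightarrow> complex" where
  "dual_pluecker c d j =
     (if j = 1 then c 3 * d 4 - c 4 * d 3
      else if j = 2 then c 4 * d 2 - c 2 * d 4
      else if j = 3 then c 2 * d 3 - c 3 * d 2
      else if j = 4 then c 1 * d 4 - c 4 * d 1
      else if j = 5 then c 1 * d 3 - c 3 * d 1
      else c 1 * d 2 - c 2 * d 1)"

lemma sum_6: "(\<Sum>i\<in>UNIV. f i) = f 1 + f 2 + f 3 + f 4 + f 5 + f (6 :: 6)"
  unfolding UNIV_6 by (simp add: add.assoc)

text \<open>
  Arrange the coordinates into the skew-symmetric matrix \<open>P\<close> of the 2-form. On the quadric \<open>P\<close> has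
  rank at most 2, so if \<open>P a b \<noteq> 0\<close> then the form is the wedge product of rows \<open>a\<close> and \<open>b\<close>, divided by
  \<open>P a b\<close>.
\<close>

lemma pluecker_quadric_decomposable:
  fixes y :: "6 \<Rightarrow> complex"
  assumes "y 1 * y 6 + y 2 * y 5 + y 3 * y 4 = 0"
  shows "\<exists>c d. dual_pluecker c d = y"
proof -
  define P :: "4 \<Rightarrow> 4 \<Rightarrow> complex" where
    "P a b = (if (a, b) = (1, 2) then y 6 else if (a, b) = (2, 1) then - y 6
      else if (a, b) = (1, 3) then y 5 else if (a, b) = (3, 1) then - y 5
      else if (a, b) = (1, 4) then y 4 else if (a, b) = (4, 1) then - y 4
      else if (a, b) = (2, 3) then y 3 else if (a, b) = (3, 2) then - y 3
      else if (a, b) = (2, 4) then - y 2 else if (a, b) = (4, 2) then y 2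
      else if (a, b) = (3, 4) then y 1 else if (a, b) = (4, 3) then - y 1 else 0)" for a b
  have P_values: "P 3 4 = y 1" "P 4 2 = y 2" "P 2 3 = y 3" "P 1 4 = y 4" "P 1 3 = y 5" "P 1 2 = y 6"
    by (simp_all add: P_def)
  have relation: "y 1 * y 6 = - (y 2 * y 5) - y 3 * y 4"
    using assms by (simp add: algebra_simps add_eq_0_iff2)
  \<comment> \<open>The order of the indices in each pair matches the signs in \<open>dual_pluecker\<close>.\<close>
  define I :: "(4 \<times> 4) set" where "I = {(1, 2), (1, 3), (1, 4), (2, 3), (4, 2), (3, 4)}"
  have "\<forall>(a, b)\<in>I. \<forall>(i, j)\<in>I. P a i * P b j - P a j * P b i = P a b * P i j"
    by (simp add: I_def P_def algebra_simps relation)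
  then have pluecker: "P a i * P b j - P a j * P b i = P a b * P i j"
    if "(a, b) \<in> I" "(i, j) \<in> I" for a b i j using that by blast
  show ?thesis
  proof (cases "\<exists>(a, b)\<in>I. P a b \<noteq> 0")
    case True
    then obtain a b where ab: "(a, b) \<in> I" "P a b \<noteq> 0" by blast
    have minors: "P a i * (P b j / P a b) - P a j * (P b i / P a b) = P i j" if "(i, j) \<in> I" for i j
      using ab pluecker[OF ab(1) that] by (simp add: field_simps)
    have "dual_pluecker (P a) (\<lambda>i. P b i / P a b) j = y j" for j
      using exhaust_6[of j] minors[of 1 2] minors[of 1 3] minors[of 1 4] minors[of 2 3]
        minors[of 4 2] minors[of 3 4]
      by (auto simp: dual_pluecker_def P_values I_def)
    then show ?thesis by blast
  next
    case False
    then have "y j = 0" for j using exhaust_6[of j] P_values by (auto simp: I_def)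
    then show ?thesis
      by (intro exI[of _ "\<lambda>_. 0"]) (auto simp: dual_pluecker_def)
  qed
qed

lemma wedge_1_1_combinations:
  fixes \<omega> :: "4 \<Rightarrow> form"
  assumes deg: "\<And>i. form_deg 1 (\<omega> i)"
  shows "wedge 1 1 (\<Sum>i\<in>UNIV. c i *\<^sub>F \<omega> i) (\<Sum>i\<in>UNIV. d i *\<^sub>F \<omega> i) =
      dual_pluecker c d 6 *\<^sub>F phi \<omega> 1 + dual_pluecker c d 5 *\<^sub>F phi \<omega> 2
    + dual_pluecker c d 4 *\<^sub>F phi \<omega> 3 + dual_pluecker c d 3 *\<^sub>F phi \<omega> 4
    + dual_pluecker c d 2 *\<^sub>F phi \<omega> 5 + dual_pluecker c d 1 *\<^sub>F phi \<omega> 6"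
proof
  fix v
  define w where "w i j = wedge 1 1 (\<omega> i) (\<omega> j) v" for i j
  have self: "w i i = 0" for i
    using fun_cong[OF wedge_self[OF deg[of i]], of v] by (simp add: w_def)
  have swap: "w i j = - w j i" for i j
    using fun_cong[OF wedge_1_1_anticommute[OF deg[of i] deg[of j]], of v] by (simp add: w_def)
  have "wedge 1 1 (\<Sum>i\<in>UNIV. c i *\<^sub>F \<omega> i) (\<Sum>i\<in>UNIV. d i *\<^sub>F \<omega> i) v =
      (\<Sum>i\<in>UNIV. \<Sum>j\<in>UNIV. c i * d j * w i j)"
    by (simp only: wedge_sum_left wedge_sum_right wedge_scale_left wedge_scale_right sum_form_apply)
      (subst sum.swap, simp add: scale_form_def sum_form_apply w_def sum_distrib_left mult_ac)
  also have "\<dots> = (c 1 * d 2 - c 2 * d 1) * w 1 2 + (c 1 * d 3 - c 3 * d 1) * w 1 3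
      + (c 1 * d 4 - c 4 * d 1) * w 1 4 + (c 2 * d 3 - c 3 * d 2) * w 2 3
      + (c 2 * d 4 - c 4 * d 2) * w 2 4 + (c 3 * d 4 - c 4 * d 3) * w 3 4"
    by (simp add: sum_4 self swap[of 2 1] swap[of 3 1] swap[of 4 1] swap[of 3 2] swap[of 4 2]
        swap[of 4 3]) (simp add: algebra_simps)
  finally show "wedge 1 1 (\<Sum>i\<in>UNIV. c i *\<^sub>F \<omega> i) (\<Sum>i\<in>UNIV. d i *\<^sub>F \<omega> i) v =
     (dual_pluecker c d 6 *\<^sub>F phi \<omega> 1 + dual_pluecker c d 5 *\<^sub>F phi \<omega> 2
    + dual_pluecker c d 4 *\<^sub>F phi \<omega> 3 + dual_pluecker c d 3 *\<^sub>F phi \<omega> 4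
    + dual_pluecker c d 2 *\<^sub>F phi \<omega> 5 + dual_pluecker c d 1 *\<^sub>F phi \<omega> 6) v"
    by (simp add: scale_form_def phi_def dual_pluecker_def w_def) (simp add: algebra_simps)
qed

text \<open>
  The pairing on 2-forms that the \<open>\<phi>\<^sup>j\<close> are adapted to. The minus sign in \<open>\<phi>\<^sup>5\<close> compensates that of
  the permutation \<open>1324\<close>.
\<close>

lemma wedge_phi_phi:
  assumes deg: "\<And>i. form_deg 1 (\<omega> i)"
  shows "wedge 2 2 (phi \<omega> j) (phi \<omega> k) =
    (if (j, k) \<in> {(1, 6), (2, 5), (3, 4), (4, 3), (5, 2), (6, 1)}
     then wedge_list [\<omega> 1, \<omega> 2, \<omega> 3, \<omega> 4] else 0)"
proof -
  define W where "W a b c d = wedge_list [\<omega> a, \<omega> b, \<omega> c, \<omega> d]" for a b c d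
  have W: "wedge 2 2 (wedge 1 1 (\<omega> a) (\<omega> b)) (wedge 1 1 (\<omega> c) (\<omega> d)) = W a b c d" for a b c d
    unfolding W_def wedge_list_two [symmetric]
    by (subst wedge_list_append) (use deg in \<open>auto simp del: wedge_list.simps One_nat_def\<close>)
  have swap: "W a b c d = - W b a c d" "W a b c d = - W a c b d" "W a b c d = - W a b d c" for a b c d
    unfolding W_def
    using wedge_list_swap[OF deg deg, of "[]" a b "[\<omega> c, \<omega> d]"]
      wedge_list_swap[OF deg deg, of "[\<omega> a]" b c "[\<omega> d]"]
      wedge_list_swap[OF deg deg, of "[\<omega> a, \<omega> b]" c d "[]"]
    by (simp_all only: append_Nil append_Cons)
  have repeat: "W a a c d = 0" "W a b b d = 0" "W a b c c = 0" for a b c d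
    unfolding W_def
    using wedge_list_repeat[OF deg, of "[]" a "[\<omega> c, \<omega> d]"]
      wedge_list_repeat[OF deg, of "[\<omega> a]" b "[\<omega> d]"]
      wedge_list_repeat[OF deg, of "[\<omega> a, \<omega> b]" c "[]"]
    by (simp_all only: append_Nil append_Cons)
  have repeat': "W a b a d = 0" "W a b c b = 0" "W a b c a = 0" for a b c d
    by (simp_all only: swap(2)[of a b a] swap(3)[of a b c] repeat minus_zero)
  have top: "W 1 3 2 4 = - W 1 2 3 4" "W 1 4 2 3 = W 1 2 3 4" "W 2 3 1 4 = W 1 2 3 4"
    "W 2 4 1 3 = - W 1 2 3 4" "W 3 4 1 2 = W 1 2 3 4"
    by (simp_all only: swap(1)[of 2 1] swap(1)[of 3 1] swap(2)[of 1 3 2] swap(2)[of 1 4 2]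
        swap(2)[of 2 3 1] swap(2)[of 2 4 1] swap(2)[of 3 4 1] swap(3)[of 1 2 4] swap(3)[of 1 3 4]
        minus_minus)
  have phi: "phi \<omega> 1 = wedge 1 1 (\<omega> 1) (\<omega> 2)" "phi \<omega> 2 = wedge 1 1 (\<omega> 1) (\<omega> 3)"
    "phi \<omega> 3 = wedge 1 1 (\<omega> 1) (\<omega> 4)" "phi \<omega> 4 = wedge 1 1 (\<omega> 2) (\<omega> 3)"
    "phi \<omega> 5 = - wedge 1 1 (\<omega> 2) (\<omega> 4)" "phi \<omega> 6 = wedge 1 1 (\<omega> 3) (\<omega> 4)"
    by (simp_all add: phi_def)
  have "wedge 2 2 (phi \<omega> j) (phi \<omega> k) =
      (if (j, k) \<in> {(1, 6), (2, 5), (3, 4), (4, 3), (5, 2), (6, 1)} then W 1 2 3 4 else 0)"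
    using exhaust_6[of j] exhaust_6[of k]
    by (elim disjE; simp only: phi wedge_minus_left wedge_minus_right W repeat repeat'
      top minus_minus minus_zero; simp)
  then show ?thesis by (simp only: W_def)
qed

lemma wedge_phi_decomposable:
  assumes deg: "\<And>i. form_deg 1 (\<omega> i)"
  shows "wedge 2 2 (phi \<omega> j)
      (wedge 1 1 (\<Sum>i\<in>UNIV. c i *\<^sub>F \<omega> i) (\<Sum>i\<in>UNIV. d i *\<^sub>F \<omega> i)) =
    dual_pluecker c d j *\<^sub>F wedge_list [\<omega> 1, \<omega> 2, \<omega> 3, \<omega> 4]"
  unfolding wedge_1_1_combinations[OF deg] wedge_add_right wedge_scale_right wedge_phi_phi[OF deg]
  using exhaust_6[of j] by (elim disjE) simp_all

lemma form_deg_phi: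
  assumes "\<And>i. form_deg 1 (\<omega> i)"
  shows "form_deg 2 (phi \<omega> j)"
proof -
  have "form_deg 2 (wedge 1 1 (\<omega> a) (\<omega> b))" for a b
    using form_deg_wedge[OF assms assms] by (simp add: numeral_2_eq_2)
  then show ?thesis by (simp add: phi_def form_deg_uminus)
qed

text \<open>
  Regrouping gives \<open>(\<phi>\<^sup>j \<and> \<psi>) \<and> cnj (\<phi>\<^sup>k \<and> \<psi>)\<close> for each pair of indices, and both factors are
  multiples of \<open>\<omega>\<^sup>1\<^sup>2\<^sup>3\<^sup>4\<close> or of its conjugate, whose product is the volume form.
\<close>

lemma wedge_square_decomposable:
  fixes A :: "complex^6^6"
  assumes basis: "basis_1_0 \<omega>"
    and \<Theta>: "\<Theta> = (\<Sum>j\<in>UNIV. \<Sum>k\<in>UNIV. (A $ j $ k) *\<^sub>F wedge 2 2 (phi \<omega> j) (cnj_form (phi \<omega> k)))"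
    and \<psi>: "\<psi> = wedge 1 1 (\<Sum>i\<in>UNIV. c i *\<^sub>F \<omega> i) (\<Sum>i\<in>UNIV. d i *\<^sub>F \<omega> i)"
  shows "wedge 6 2 (wedge 4 2 \<Theta> \<psi>) (cnj_form \<psi>) =
    (\<Sum>j\<in>UNIV. \<Sum>k\<in>UNIV. A $ j $ k * dual_pluecker c d j * cnj (dual_pluecker c d k)) *\<^sub>F Vol \<omega>"
proof -
  let ?y = "dual_pluecker c d"
  let ?top = "wedge_list [\<omega> 1, \<omega> 2, \<omega> 3, \<omega> 4]"
  have deg: "form_deg 1 (\<omega> i)" for i by (intro form_deg_1_0 basis_in_forms basis)
  have deg_\<psi>: "form_deg 2 \<psi>"
    using form_deg_wedge[OF form_deg_1_0 form_deg_1_0, OF sum_scale_in_forms sum_scale_in_forms, OF basis basis]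
    by (simp add: \<psi> numeral_2_eq_2)
  have Vol: "wedge 4 4 ?top (cnj_form ?top) = Vol \<omega>"
    unfolding Vol_def cnj_wedge_list
    by (subst wedge_list_append) (use deg in \<open>auto simp del: wedge_list.simps One_nat_def\<close>)
  have "wedge 6 2 (wedge 4 2 (wedge 2 2 (phi \<omega> j) (cnj_form (phi \<omega> k))) \<psi>) (cnj_form \<psi>) =
      (?y j * cnj (?y k)) *\<^sub>F Vol \<omega>" for j k
  proof -
    have "wedge 6 2 (wedge 4 2 (wedge 2 2 (phi \<omega> j) (cnj_form (phi \<omega> k))) \<psi>) (cnj_form \<psi>) =
        wedge 4 4 (wedge 2 2 (phi \<omega> j) \<psi>) (cnj_form (wedge 2 2 (phi \<omega> k) \<psi>))"
      by (simp add: wedge_four_2_forms form_deg_phi[OF deg] form_deg_cnj deg_\<psi> cnj_wedge)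
    also have "\<dots> = wedge 4 4 (?y j *\<^sub>F ?top) (cnj (?y k) *\<^sub>F cnj_form ?top)"
      unfolding \<psi> wedge_phi_decomposable[OF deg] cnj_scale_form ..
    finally show ?thesis
      by (simp only: wedge_scale_left wedge_scale_right Vol form.scale_scale mult.commute)
  qed
  then show ?thesis
    unfolding \<Theta> wedge_sum_left wedge_scale_left
    by (simp only: form.scale_scale form.scale_sum_left mult.assoc)
qed

text \<open>
  Every point \<open>y\<close> of the quadric is realised by a decomposable \<open>\<psi>\<close>. Weak positivity gives
  \<open>Q Vol = r Vol\<close> with \<open>r \<ge> 0\<close> for the value \<open>Q\<close> at \<open>y\<close>, and evaluating both sides where \<open>Vol\<close> does
  not vanish identifies \<open>Q\<close> with \<open>r\<close>.
\<close>

lemma weakly_positive_on_quadric: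
  fixes A :: "complex^6^6"
  assumes basis: "basis_1_0 \<omega>"
    and \<Theta>: "\<Theta> = (\<Sum>j\<in>UNIV. \<Sum>k\<in>UNIV. (A $ j $ k) *\<^sub>F wedge 2 2 (phi \<omega> j) (cnj_form (phi \<omega> k)))"
    and "weakly_positive \<omega> \<Theta>"
    and y: "y 1 * y 6 + y 2 * y 5 + y 3 * y 4 = 0"
  shows "(\<Sum>j\<in>UNIV. \<Sum>k\<in>UNIV. A $ j $ k * y j * cnj (y k)) \<in> \<real>\<^sub>\<ge>\<^sub>0" (is "?Q \<in> _")
proof -
  obtain c d where cd: "dual_pluecker c d = y"
    using pluecker_quadric_decomposable[OF y] by blast
  define \<psi> where "\<psi> = wedge 1 1 (\<Sum>i\<in>UNIV. c i *\<^sub>F \<omega> i) (\<Sum>i\<in>UNIV. d i *\<^sub>F \<omega> i)"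
  have "\<psi> \<in> decomposable_2_0"
    unfolding \<psi>_def decomposable_2_0_def using sum_scale_in_forms[OF basis] by blast
  then have "nonneg_4_4 \<omega> (wedge 6 2 (wedge 4 2 \<Theta> \<psi>) (cnj_form \<psi>))"
    using assms(3) by (simp add: weakly_positive_def)
  then have "nonneg_4_4 \<omega> (?Q *\<^sub>F Vol \<omega>)"
    unfolding wedge_square_decomposable[OF basis \<Theta> \<psi>_def] cd .
  then obtain r :: real where r: "0 \<le> r" "?Q *\<^sub>F Vol \<omega> = of_real r *\<^sub>F Vol \<omega>"
    by (auto simp: nonneg_4_4_def)
  obtain v where "Vol \<omega> v \<noteq> 0" using Vol_nonzero[OF basis] by blast
  with fun_cong[OF r(2), of v] have "?Q = of_real r" by (simp add: scale_form_def)
  with r(1) show ?thesis by simp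
qed

section \<open>Sesquilinear forms that are non-negative on a quadric\<close>

text \<open>
  Averaging over the sign of \<open>(y l, y m)\<close> decouples the two pairs, after which the phases of
  \<open>y j * cnj (y k)\<close> and \<open>y l * cnj (y m)\<close> vary independently. That all values are real gives
  \<open>a k j = cnj (a j k)\<close> and \<open>a m l = cnj (a l m)\<close>, and rotating \<open>a j k\<close> and \<open>a l m\<close> onto the negative
  real axis gives the bound.
\<close>

lemma quadric_bound:
  fixes a :: "'i::finite \<Rightarrow> 'i \<Rightarrow> complex"
  assumes dist: "distinct [j, k, l, m]"
    and pos: "\<And>y. (\<And>i. i \<notin> {j, k, l, m} \<Longrightarrow> y i = 0) \<Longrightarrow> y j * y k + y l * y m = 0 \<Longrightarrow>
      (\<Sum>p\<in>UNIV. \<Sum>q\<in>UNIV. a p q * y p * cnj (y q)) \<in> \<real>\<^sub>\<ge>\<^sub>0"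
  shows "cmod (a j k) + cmod (a l m) \<le> Re (a j j + a k k + a l l + a m m) / 2"
proof -
  define S where "S = a j j + a k k + a l l + a m m"
  define g where "g p q u = u * a p q + cnj u * a q p" for p q u
  have average: "S + g j k u + g l m v \<in> \<real>\<^sub>\<ge>\<^sub>0" if "cmod u = 1" "cmod v = 1" for u v
  proof -
    \<comment> \<open>With \<open>y\<^sub>j = u\<close>, \<open>y\<^sub>k = 1\<close>, \<open>y\<^sub>l = v t\<close>, \<open>y\<^sub>m = t\<close> the phase \<open>t\<close> puts \<open>y\<close> on the quadric.\<close>
    define t where "t = csqrt (- u / v)"
    have "v \<noteq> 0" using that by auto
    then have t: "u + v * t\<^sup>2 = 0" by (simp add: t_def)
    have "cmod (t\<^sup>2) = 1" using that by (simp add: t_def norm_divide)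
    then have "cmod t = 1" using norm_ge_zero[of t] by (simp add: norm_power power2_eq_1_iff)
    then have unit: "u * cnj u = 1" "v * cnj v = 1" "t * cnj t = 1"
      using that by (simp_all add: complex_mult_cnj cmod_def flip: complex_norm_square)
    define y where "y s i = (if i = j then u else if i = k then 1 else if i = l then s * (v * t)
      else if i = m then s * t else 0)" for s i
    have y_values: "y s j = u" "y s k = 1" "y s l = s * (v * t)" "y s m = s * t" for s
      using dist by (auto simp: y_def)
    define Q where "Q s = (\<Sum>p\<in>UNIV. \<Sum>q\<in>UNIV. a p q * y s p * cnj (y s q))" for s :: complex
    have Q_nonneg: "Q s \<in> \<real>\<^sub>\<ge>\<^sub>0" if "s * s = 1" for s
      unfolding Q_def
    proof (rule pos)
      show "y s i = 0" if "i \<notin> {j, k, l, m}" for i using that by (simp add: y_def)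
      have "s * (v * t) * (s * t) = (s * s) * (v * t\<^sup>2)" by (simp add: power2_eq_square)
      with t show "y s j * y s k + y s l * y s m = 0"
        using \<open>s * s = 1\<close> by (simp only: y_values mult_1_left mult_1_right)
    qed
    have supp: "(\<Sum>p\<in>UNIV. h p) = h j + h k + h l + h m"
      if "\<And>p. p \<notin> {j, k, l, m} \<Longrightarrow> h p = 0" for h :: "'i \<Rightarrow> complex"
    proof -
      have "(\<Sum>p\<in>UNIV. h p) = (\<Sum>p\<in>{j, k, l, m}. h p)"
        by (rule sum.mono_neutral_right) (use that in auto)
      then show ?thesis using dist by (simp add: add.assoc)
    qed
    have y_supp: "y s p = 0" if "p \<notin> {j, k, l, m}" for s p using that by (simp add: y_def)
    have Q_eq: "Q s = (\<Sum>p\<in>UNIV. (a p j * cnj (y s j) + a p k * cnj (y s k) + a p l * cnj (y s l)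
        + a p m * cnj (y s m)) * y s p)" for s
      unfolding Q_def
      by (intro sum.cong refl, subst supp) (simp_all add: y_supp algebra_simps)
    \<comment> \<open>The terms that mix \<open>{j, k}\<close> with \<open>{l, m}\<close> are odd in \<open>s\<close>.\<close>
    have "Q 1 + Q (- 1) = 2 * (a j j * (u * cnj u) + a k k + a l l * (v * cnj v) * (t * cnj t)
        + a m m * (t * cnj t) + g j k u + g l m v * (t * cnj t))"
      unfolding Q_eq by (subst (1 2) supp) (simp_all add: y_supp y_values g_def algebra_simps)
    then have "Q 1 + Q (- 1) = 2 * (S + g j k u + g l m v)"
      by (simp add: unit S_def add_ac)
    moreover have "Q 1 + Q (- 1) \<in> \<real>\<^sub>\<ge>\<^sub>0" by (intro nonneg_Reals_add_I Q_nonneg) auto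
    ultimately show ?thesis by (simp add: complex_nonneg_Reals_iff)
  qed
  have g_minus: "g p q (- u) = - g p q u" for p q u by (simp add: g_def)
  have g_Im: "Im (g j k u) = 0" "Im (g l m u) = 0" "Im S = 0" if "cmod u = 1" for u
    using average[of u 1] average[of u "- 1"] average[of "- u" 1] average[of "- u" "- 1"]
      average[of 1 u] average[of "- 1" u] average[of 1 "- u"] average[of "- 1" "- u"] that
    by (auto simp: complex_nonneg_Reals_iff g_minus)
  \<comment> \<open>\<open>u a + cnj u b\<close> is real for \<open>u = 1\<close> and \<open>u = \<i>\<close> only if \<open>b = cnj a\<close>.\<close>
  have hermitian: "a k j = cnj (a j k)" "a m l = cnj (a l m)"
    using g_Im(1)[of 1] g_Im(1)[of \<i>] g_Im(2)[of 1] g_Im(2)[of \<i>]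
    by (auto simp: g_def complex_eq_iff)
  have rotate: "\<exists>u. cmod u = 1 \<and> u * z = - of_real (cmod z)" for z
  proof (cases "z = 0")
    case False
    then show ?thesis
      by (intro exI[of _ "- of_real (cmod z) / z"]) (simp add: norm_divide)
  qed (auto intro!: exI[of _ 1])
  obtain u v where u: "cmod u = 1" "u * a j k = - of_real (cmod (a j k))"
    and v: "cmod v = 1" "v * a l m = - of_real (cmod (a l m))"
    using rotate by metis
  have "cnj u * cnj (a j k) = - of_real (cmod (a j k))"
    "cnj v * cnj (a l m) = - of_real (cmod (a l m))"
    using arg_cong[OF u(2), of cnj] arg_cong[OF v(2), of cnj] by simp_all
  then have "g j k u = - of_real (2 * cmod (a j k))" "g l m v = - of_real (2 * cmod (a l m))"
    by (simp_all add: g_def hermitian u(2) v(2))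
  with average[OF u(1) v(1)] show ?thesis
    by (simp add: complex_nonneg_Reals_iff S_def)
qed

section \<open>The entries of the Hermitian matrix of a weakly positive form\<close>

theorem theorem4p5:
  fixes \<omega> :: "4 \<Rightarrow> form" and A :: "complex^6^6" and \<Theta> :: form
  assumes "basis_1_0 \<omega>"
    and "\<Theta> = (\<Sum>j\<in>UNIV. \<Sum>k\<in>UNIV. (A $ j $ k) *\<^sub>F wedge 2 2 (phi \<omega> j) (cnj_form (phi \<omega> k)))"
    and "real_2_2_form \<Theta>"
    and "weakly_positive \<omega> \<Theta>"
  shows "(\<forall>(j, k) \<in> {(1, 6), (2, 5), (3, 4)}. \<forall>(l, m) \<in> {(1, 6), (2, 5), (3, 4)}.
            (j, k) \<noteq> (l, m) \<longrightarrow>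
              cmod (A $ j $ k + A $ l $ m) \<le> Re (A $ j $ j + A $ k $ k + A $ l $ l + A $ m $ m) / 2 \<and>
              cmod (A $ j $ k - A $ l $ m) \<le> Re (A $ j $ j + A $ k $ k + A $ l $ l + A $ m $ m) / 2) \<and>
         cmod (A $ 1 $ 6) \<le> Re (trace A) / 2 \<and>
         cmod (A $ 2 $ 5) \<le> Re (trace A) / 2 \<and>
         cmod (A $ 3 $ 4) \<le> Re (trace A) / 2"
proof -
  let ?I = "{(1, 6), (2, 5), (3, 4)} :: (6 \<times> 6) set"
  have bound: "cmod (A $ j $ k) + cmod (A $ l $ m) \<le> Re (A $ j $ j + A $ k $ k + A $ l $ l + A $ m $ m) / 2"
    if "(j, k) \<in> ?I" "(l, m) \<in> ?I" "(j, k) \<noteq> (l, m)" for j k l m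
  proof (rule quadric_bound[where a = "\<lambda>p q. A $ p $ q"])
    show "distinct [j, k, l, m]" using that by auto
    fix y :: "6 \<Rightarrow> complex"
    assume supp: "\<And>i. i \<notin> {j, k, l, m} \<Longrightarrow> y i = 0" and rel: "y j * y k + y l * y m = 0"
    have "y 1 * y 6 + y 2 * y 5 + y 3 * y 4 = 0"
      using that rel supp[of 1] supp[of 2] supp[of 3]
      by (elim insertE emptyE Pair_inject; simp add: add.commute)
    then show "(\<Sum>p\<in>UNIV. \<Sum>q\<in>UNIV. A $ p $ q * y p * cnj (y q)) \<in> \<real>\<^sub>\<ge>\<^sub>0"
      by (rule weakly_positive_on_quadric[OF assms(1,2,4)])
  qed
  have pairs: "cmod (A $ j $ k + A $ l $ m) \<le> Re (A $ j $ j + A $ k $ k + A $ l $ l + A $ m $ m) / 2 \<and>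
      cmod (A $ j $ k - A $ l $ m) \<le> Re (A $ j $ j + A $ k $ k + A $ l $ l + A $ m $ m) / 2"
    if "(j, k) \<in> ?I" "(l, m) \<in> ?I" "(j, k) \<noteq> (l, m)" for j k l m
    using bound[OF that] norm_triangle_ineq[of "A $ j $ k" "A $ l $ m"]
      norm_triangle_ineq4[of "A $ j $ k" "A $ l $ m"] by linarith
  \<comment> \<open>Every diagonal entry occurs in two of the three bounds.\<close>
  have "2 * (cmod (A $ 1 $ 6) + cmod (A $ 2 $ 5) + cmod (A $ 3 $ 4)) \<le> Re (trace A)"
  proof -
    have "trace A = A $ 1 $ 1 + A $ 2 $ 2 + A $ 3 $ 3 + A $ 4 $ 4 + A $ 5 $ 5 + A $ 6 $ 6"
      unfolding trace_def by (rule sum_6)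
    moreover have "cmod (A $ 1 $ 6) + cmod (A $ 2 $ 5) \<le> Re (A $ 1 $ 1 + A $ 6 $ 6 + A $ 2 $ 2 + A $ 5 $ 5) / 2"
      "cmod (A $ 1 $ 6) + cmod (A $ 3 $ 4) \<le> Re (A $ 1 $ 1 + A $ 6 $ 6 + A $ 3 $ 3 + A $ 4 $ 4) / 2"
      "cmod (A $ 2 $ 5) + cmod (A $ 3 $ 4) \<le> Re (A $ 2 $ 2 + A $ 5 $ 5 + A $ 3 $ 3 + A $ 4 $ 4) / 2"
      by (rule bound; simp)+
    ultimately show ?thesis by (simp only: plus_complex.sel) argo
  qed
  then have singles: "cmod (A $ 1 $ 6) \<le> Re (trace A) / 2" "cmod (A $ 2 $ 5) \<le> Re (trace A) / 2"
    "cmod (A $ 3 $ 4) \<le> Re (trace A) / 2"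
    using norm_ge_zero[of "A $ 1 $ 6"] norm_ge_zero[of "A $ 2 $ 5"] norm_ge_zero[of "A $ 3 $ 4"]
    by - argo+
  show ?thesis
    by (intro conjI singles) (simp only: Ball_def split_paired_All prod.case, intro allI impI pairs)
qed

end
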